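(* Let $t_0<t_1<\dots<t_N$, $I=[t_0,t_N]$, and let $\{y_1,\dots,y_N\}\subset\mathbb{R}$ be the corresponding histogram ($y_j$ is the frequency of the interval $I_j$). Let $l_j$, $F_j$ (with constants $a_j,c_j,\delta_j,d_j$ and maps $s_j$) be as in the context, let $w_j(t,x)=(l_j(t),F_j(t,x))$ and let $\mathcal{I}=\{I\times\mathbb{R};w_j,\ j=1,\dots,N\}$ be the associated iterated function system. Assume that $c_j$ and $\delta_j$ are fixed with $\max_{1\le j\le N}|\delta_j|<1$ (and $\max_{1\le j\le N}|a_j|<1$). Let $f\in\mathcal{B}(I)$ be the fixed point of the Read-Bajraktarević operator $T$ described in the context. Then $f$ solves the histopolation problem, i.e. $$\int_{t_{j-1}}^{t_j}f(t)\,dt=y_j\,a_j\,(t_N-t_0)\qquad\text{for all } j\in\{1,\dots,N\},$$ if and only if, for all $j\in\{1,\dots,N\}$, $$d_j=\frac{2y_j(t_N-t_0)-c_j(t_N^2-t_0^2)-2\delta_j\int_I s_j(f(t))\,dt}{2(t_N-t_0)}.$$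
   Context: Rakotch contraction: let $(X,\rho)$ be a metric space and $\mathbb{R}_+=[0,\infty)$. A map $g:X\to X$ is a Rakotch contraction with respect to a function $\psi:\mathbb{R}_+\to\mathbb{R}_+$ if $\rho(g(x),g(y))\le\psi(\rho(x,y))$ for all $x,y\in X$, where $\psi$ satisfies $\frac{\psi(s)}{s}<1$ for all $s>0$ and $\frac{\psi(t)}{t}\le\frac{\psi(s)}{s}$ for all $t>s>0$. Setting: $N>1$ is an integer, $t_0<t_1<\dots<t_N$ are real numbers, $I=[t_0,t_N]$, $I_j=[t_{j-1},t_j)$ for $1\le j\le N-1$, and $I_N=[t_{N-1},t_N]$. For $1\le j\le N$, $l_j:I\to I$ is the affine map $l_j(t)=a_jt+b_j$ determined by $l_j(t_0)=t_{j-1}$ and $l_j(t_N)=t_j$; thus $I_j$ has length $a_j(t_N-t_0)$. The maps $F_j:I\times\mathbb{R}\to\mathbb{R}$ are $F_j(t,x)=c_jt+\delta_js_j(x)+d_j$, where $s_1,\dots,s_N:\mathbb{R}\to\mathbb{R}$ are Rakotch contractions (for the usual metric on $\mathbb{R}$) all with respect to the same function $\psi$, and $c_j,d_j,\delta_j$ are real constants. $\mathcal{B}(I)$ is the space of bounded real-valued functions on $I$ with the norm $\|h\|_\infty=\sup_{t\in I}|h(t)|$. The Read-Bajraktarević operator $T:\mathcal{B}(I)\to\mathcal{B}(I)$ is defined by $Th(t)=F_j(l_j^{-1}(t),h(l_j^{-1}(t)))=c_jl_j^{-1}(t)+\delta_js_j(h(l_j^{-1}(t)))+d_j$ for $t\in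 I_j$, $1\le j\le N$. It is known that, when $\max_j|\delta_j|<1$, $T$ has a unique fixed point $f\in\mathcal{B}(I)$ and that $f$ is Riemann integrable on $I$; integrals are Riemann integrals. Note that $f$ depends on the constants $d_1,\dots,d_N$. *)

theory Defs
  imports "HOL-Analysis.Analysis"
begin

text \<open>Functions from \<open>[0,\<infinity>)\<close> to itself are represented by functions on all reals;
  only their values on \<open>[0,\<infinity>)\<close> are constrained.\<close>

definition rakotch_function :: "(real \<Rightarrow> real) \<Rightarrow> bool" where
  "rakotch_function \<psi> \<longleftrightarrow>
     (\<forall>s\<ge>0. 0 \<le> \<psi> s) \<and>
     (\<forall>s>0. \<psi> s / s < 1) \<and>
     (\<forall>s t. 0 < s \<and> s < t \<longrightarrow> \<psi> t / t \<le> \<psi> s / s)"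

definition rakotch_contraction :: "(real \<Rightarrow> real) \<Rightarrow> ('a::metric_space \<Rightarrow> 'a) \<Rightarrow> bool" where
  "rakotch_contraction \<psi> g \<longleftrightarrow>
     rakotch_function \<psi> \<and> (\<forall>x y. dist (g x) (g y) \<le> \<psi> (dist x y))"

definition bounded_functions :: "real set \<Rightarrow> (real \<Rightarrow> real) set" where
  "bounded_functions I = {h. bounded (h ` I)}"

text \<open>The pieces are half-open except for the last one, so that they partition
  \<open>[t\<^sub>0, t\<^sub>N]\<close>.\<close>

definition hist_interval :: "(nat \<Rightarrow> real) \<Rightarrow> nat \<Rightarrow> nat \<Rightarrow> real set" where
  "hist_interval t N j = (if j = N then {t (N - 1)..t N} else {t (j - 1)..<t j})"

text \<open>Only the values at points \<open>u\<close> of \<open>[t\<^sub>0, t\<^sub>N]\<close> are meaningful: there the index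
  \<open>j\<close> exists and is unique.\<close>

definition read_bajraktarevic ::
  "(nat \<Rightarrow> real) \<Rightarrow> nat \<Rightarrow> (nat \<Rightarrow> real \<Rightarrow> real) \<Rightarrow> (nat \<Rightarrow> real \<times> real \<Rightarrow> real)
    \<Rightarrow> (real \<Rightarrow> real) \<Rightarrow> real \<Rightarrow> real" where
  "read_bajraktarevic t N l F h u =
     (let j = (THE j. j \<in> {1..N} \<and> u \<in> hist_interval t N j);
          v = inv_into {t 0..t N} (l j) u
      in F j (v, h v))"

end

theory Submission imports Defs begin

text \<open>The fixed point \<open>f\<close> is the pointwise limit of the iterates of the operator started at \<open>0\<close>,
  since Rakotch contractions are nonexpansive and \<open>max \<bar>\<delta>\<^sub>j\<bar> < 1\<close>; hence it is Borel measurable,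
  and, being bounded, integrable on \<open>[t\<^sub>0, t\<^sub>N]\<close>. Substituting \<open>u = l\<^sub>j v\<close> in the fixed point equation,
  the integral of \<open>f\<close> over the \<open>j\<close>-th piece is \<open>a\<^sub>j\<close> times the integral of
  \<open>c\<^sub>j v + \<delta>\<^sub>j s\<^sub>j (f v) + d\<^sub>j\<close> over \<open>[t\<^sub>0, t\<^sub>N]\<close>,
  an affine function of \<open>d\<^sub>j\<close> with nonzero slope once \<open>f\<close> is held fixed.\<close>

section \<open>Rakotch contractions as nonexpansive maps\<close>

text \<open>The ratio condition gives \<open>\<psi> r < r\<close> for \<open>r > 0\<close> only,
  hence the split on \<open>x = y\<close>. Nonexpansiveness is the form in which the maps
  \<open>s j\<close> later combine with the factors \<open>\<delta> j\<close>.\<close>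

lemma rakotch_contraction_dist_le:
  assumes "rakotch_contraction \<psi> g"
  shows "dist (g x) (g y) \<le> dist x y"
proof (cases "x = y")
  case False
  then have "\<psi> (dist x y) / dist x y < 1"
    using assms by (simp add: rakotch_contraction_def rakotch_function_def)
  with False have "\<psi> (dist x y) < dist x y" by (simp add: divide_simps)
  moreover have "dist (g x) (g y) \<le> \<psi> (dist x y)"
    using assms by (simp add: rakotch_contraction_def)
  ultimately show ?thesis by simp
qed simp

lemma rakotch_contraction_continuous_on:
  assumes "rakotch_contraction \<psi> g"
  shows "continuous_on S g"
  unfolding continuous_on_iff
  using rakotch_contraction_dist_le[OF assms] by (meson order.strict_trans1)

section \<open>The partition of the interval into histogram pieces\<close>

lemma partition_less:
  fixes t :: "nat \<Rightarrow> real"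
  assumes "\<forall>j\<in>{1..N}. t (j - 1) < t j" "i < k" "k \<le> N"
  shows "t i < t k"
  using assms(2,3)
proof (induction k)
  case (Suc k)
  have "t k < t (Suc k)" using assms(1) Suc.prems(2) by force
  with Suc show ?case by (cases "i = k") auto
qed simp

lemma partition_le:
  fixes t :: "nat \<Rightarrow> real"
  assumes "\<forall>j\<in>{1..N}. t (j - 1) < t j" "i \<le> k" "k \<le> N"
  shows "t i \<le> t k"
  using partition_less[OF assms(1), of i k] assms(2,3) by (cases "i = k") auto

lemma hist_interval_subset: "hist_interval t N j \<subseteq> {t (j - 1)..t j}"
  by (auto simp: hist_interval_def)

text \<open>The index is the least \<open>k\<close> with \<open>u < t k\<close>: it is positive
  because \<open>t 0 \<le> u\<close>, and minimality gives \<open>t (k - 1) \<le> u\<close>. If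
  there is no such \<open>k\<close>, then \<open>u\<close> lies in the last piece, which is closed
  on the right.\<close>

lemma hist_interval_exists:
  assumes "1 \<le> N" "u \<in> {t 0..t N}"
  shows "\<exists>j\<in>{1..N}. u \<in> hist_interval t N j"
proof (cases "\<exists>k\<le>N. u < t k")
  case True
  define k where "k = (LEAST k. k \<le> N \<and> u < t k)"
  have k: "k \<le> N" "u < t k" using LeastI_ex[OF True] by (auto simp: k_def)
  have "k \<noteq> 0" using k assms(2) by (metis atLeastAtMost_iff not_le)
  then have "\<not> (k - 1 \<le> N \<and> u < t (k - 1))"
    using not_less_Least[of "k - 1" "\<lambda>k. k \<le> N \<and> u < t k"] by (simp add: k_def[symmetric])
  with k \<open>k \<noteq> 0\<close> show ?thesis
    by (intro bexI[of _ k]) (auto simp: hist_interval_def)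
next
  case False
  then have "t (N - 1) \<le> u" by (meson diff_le_self not_le)
  with assms show ?thesis
    by (intro bexI[of _ N]) (auto simp: hist_interval_def)
qed

lemma hist_interval_unique:
  assumes "\<forall>j\<in>{1..N}. t (j - 1) < t j"
    and "i \<in> {1..N}" "k \<in> {1..N}" "u \<in> hist_interval t N i" "u \<in> hist_interval t N k"
  shows "i = k"
proof -
  have False if "i < k" "k \<in> {1..N}"
    "u \<in> hist_interval t N i" "u \<in> hist_interval t N k" for i k
  proof -
    have "t i \<le> t (k - 1)" using partition_le[OF assms(1), of i "k - 1"] that by force
    \<comment> \<open>Since \<open>i < k\<close> and \<open>k \<le> N\<close>, piece
      \<open>i\<close> is not the last one, so it is open on the right.\<close>
    moreover have "u < t i" using that by (auto simp: hist_interval_def)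
    moreover have "t (k - 1) \<le> u" using that by (auto simp: hist_interval_def split: if_splits)
    ultimately show False by simp
  qed
  with assms show ?thesis by (meson linorder_neqE_nat)
qed

section \<open>Measurability of the fixed point\<close>

lemma piecewise_fixed_point_borel_measurable:
  fixes f :: "real \<Rightarrow> real" and v :: "'j \<Rightarrow> real \<Rightarrow> real" and \<Phi> :: "'j \<Rightarrow> real \<Rightarrow> real \<Rightarrow> real"
  assumes "finite J" and "I \<in> sets borel" and A: "\<And>j. j \<in> J \<Longrightarrow> A j \<in> sets borel"
    and disj: "disjoint_family_on A J" and cover: "I \<subseteq> (\<Union>j\<in>J. A j)"
    and v: "\<And>j. j \<in> J \<Longrightarrow> v j \<in> borel_measurable borel"
    and vI: "\<And>j u. j \<in> J \<Longrightarrow> u \<in> A j \<Longrightarrow> v j u \<in> I"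
    and \<Phi>: "\<And>j. j \<in> J \<Longrightarrow> (\<lambda>(p, x). \<Phi> j p x) \<in> borel_measurable (borel \<Otimes>\<^sub>M borel)"
    and lip: "\<And>j p x z. j \<in> J \<Longrightarrow> \<bar>\<Phi> j p x - \<Phi> j p z\<bar> \<le> q * \<bar>x - z\<bar>"
    and q: "0 \<le> q" "q < 1"
    and bdd: "bounded (f ` I)"
    and fix_eq: "\<And>j u. j \<in> J \<Longrightarrow> u \<in> A j \<Longrightarrow> f u = \<Phi> j (v j u) (f (v j u))"
  shows "(\<lambda>u. indicator I u * f u) \<in> borel_measurable borel"
proof -
  \<comment> \<open>Writing the case distinction as a sum of indicators makes each iterate a total
    function, measurable by closure under finite sums and products.\<close>
  define g :: "nat \<Rightarrow> real \<Rightarrow> real" where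
    "g = rec_nat (\<lambda>_. 0) (\<lambda>_ h u. \<Sum>j\<in>J. indicator (A j) u * \<Phi> j (v j u) (h (v j u)))"
  have g_0: "g 0 = (\<lambda>_. 0)"
    and g_Suc: "g (Suc n) = (\<lambda>u. \<Sum>j\<in>J. indicator (A j) u * \<Phi> j (v j u) (g n (v j u)))" for n
    by (simp_all add: g_def)
  have g_meas: "g n \<in> borel_measurable borel" for n
  proof (induction n)
    case (Suc n)
    have "(\<lambda>u. \<Phi> j (v j u) (g n (v j u))) \<in> borel_measurable borel" if "j \<in> J" for j
    proof -
      have "(\<lambda>u. (v j u, g n (v j u))) \<in> borel \<rightarrow>\<^sub>M borel \<Otimes>\<^sub>M borel"
        using v[OF that] measurable_compose[OF v[OF that] Suc] by (rule measurable_Pair)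
      from measurable_compose[OF this \<Phi>[OF that]] show ?thesis by simp
    qed
    then show ?case
      unfolding g_Suc using A
      by (intro borel_measurable_sum borel_measurable_times borel_measurable_indicator) auto
  qed (simp add: g_0)
  have g_eq: "g (Suc n) u = \<Phi> j (v j u) (g n (v j u))" if "j \<in> J" "u \<in> A j" for n j u
  proof -
    have "indicator (A i) u = (if i = j then 1 else 0 :: real)" if "i \<in> J" for i
      using disj \<open>j \<in> J\<close> \<open>u \<in> A j\<close> that by (auto simp: disjoint_family_on_def indicator_def)
    then have "g (Suc n) u = (\<Sum>i\<in>J. if i = j then \<Phi> i (v i u) (g n (v i u)) else 0)"
      unfolding g_Suc by (intro sum.cong) auto
    then show ?thesis using that \<open>finite J\<close> by simp
  qed
  obtain B where B: "\<And>u. u \<in> I \<Longrightarrow> \<bar>f u\<bar> \<le> B"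
    using bdd by (auto simp: bounded_iff)
  \<comment> \<open>The point must vary in the induction: the error at \<open>u\<close> is at most
    \<open>q\<close> times the error at \<open>v j u\<close>, which again lies in \<open>I\<close>.
    The start \<open>g 0 = 0\<close> has error at most \<open>B\<close>.\<close>
  have err: "\<bar>g n u - f u\<bar> \<le> q ^ n * B" if "u \<in> I" for n u
    using that
  proof (induction n arbitrary: u)
    case 0
    then show ?case using B by (simp add: g_0)
  next
    case (Suc n)
    obtain j where j: "j \<in> J" "u \<in> A j" using cover Suc.prems by blast
    have "\<bar>g (Suc n) u - f u\<bar> \<le> q * \<bar>g n (v j u) - f (v j u)\<bar>"
      unfolding g_eq[OF j] fix_eq[OF j] by (rule lip[OF j(1)])
    also have "\<dots> \<le> q * (q ^ n * B)"
      using Suc.IH[OF vI[OF j]] q(1) by (rule mult_left_mono)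
    finally show ?case by (simp add: mult_ac)
  qed
  have "(\<lambda>n. indicator I u * g n u) \<longlonglongrightarrow> indicator I u * f u" for u
  proof (cases "u \<in> I")
    case True
    have "(\<lambda>n. q ^ n * B) \<longlonglongrightarrow> 0"
      using q by (intro tendsto_mult_left_zero LIMSEQ_power_zero) auto
    then have "(\<lambda>n. g n u - f u) \<longlonglongrightarrow> 0"
      by (rule Lim_null_comparison[rotated]) (simp add: err[OF True])
    then show ?thesis using True by (simp add: LIM_zero_iff)
  qed simp
  moreover have "(\<lambda>u. indicator I u * g n u) \<in> borel_measurable borel" for n
    using \<open>I \<in> sets borel\<close> by (rule borel_measurable_times[OF borel_measurable_indicator g_meas])
  ultimately show ?thesis by (rule borel_measurable_LIMSEQ_real)
qed

section \<open>Integrability and affine substitution\<close>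

text \<open>The values of \<open>f\<close> on the interval have compact closure, on which the
  continuous \<open>s\<close> is bounded; a bounded measurable function on a set of finite measure
  is Lebesgue integrable.\<close>

lemma integrable_on_continuous_compose:
  fixes f s :: "real \<Rightarrow> real"
  assumes s: "continuous_on UNIV s" and bdd: "bounded (f ` {p..q})"
    and meas: "(\<lambda>u. indicator {p..q} u * f u) \<in> borel_measurable borel"
  shows "(\<lambda>u. s (f u)) integrable_on {p..q}"
proof -
  have "compact (s ` closure (f ` {p..q}))"
    using bdd s by (intro compact_continuous_image) (auto intro: continuous_on_subset)
  then obtain B where B: "\<And>x. x \<in> s ` closure (f ` {p..q}) \<Longrightarrow> norm x \<le> B"
    using compact_imp_bounded bounded_iff by metis
  \<comment> \<open>Only the truncated \<open>f\<close> is known to be measurable, so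
    \<open>s\<close> is applied to it. The outer indicator added next removes the value
    \<open>s 0\<close> taken outside the interval.\<close>
  have "(\<lambda>u. s (indicator {p..q} u * f u)) \<in> borel_measurable borel"
    using borel_measurable_continuous_onI[OF s] meas by (rule measurable_compose[rotated])
  then have meas_comp:
    "(\<lambda>u. indicator {p..q} u * s (indicator {p..q} u * f u)) \<in> borel_measurable borel"
    by simp
  have "integrable lborel (\<lambda>u. indicator {p..q} u * s (indicator {p..q} u * f u))"
  proof (rule integrableI_bounded_set[where A = "{p..q}" and B = B])
    show "(\<lambda>u. indicator {p..q} u * s (indicator {p..q} u * f u)) \<in> borel_measurable lborel"
      using meas_comp by simp
    have "norm (s (f u)) \<le> B" if "u \<in> {p..q}" for u
      using that by (intro B imageI subsetD[OF closure_subset])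
    then show "AE u in lborel. u \<in> {p..q} \<longrightarrow>
        norm (indicator {p..q} u * s (indicator {p..q} u * f u)) \<le> B"
      by (intro AE_I2) simp
  qed (auto simp: emeasure_lborel_Icc_eq)
  moreover have "(\<lambda>u. indicator {p..q} u * s (indicator {p..q} u * f u)) =
      (\<lambda>u. indicator {p..q} u *\<^sub>R s (f u))"
    by (auto simp: indicator_def)
  ultimately have "set_integrable lborel {p..q} (\<lambda>u. s (f u))"
    by (simp add: set_integrable_def)
  then show ?thesis by (rule set_borel_integral_eq_integral(1))
qed

lemma has_integral_affine_image:
  fixes G :: "real \<Rightarrow> real"
  assumes "(G has_integral K) {p..q}" "0 < a"
  shows "((\<lambda>u. G ((u - b) / a)) has_integral a * K) {a * p + b..a * q + b}"
proof (cases "p \<le> q")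
  case True
  have "((\<lambda>u. G ((1 / a) *\<^sub>R u + - b / a)) has_integral
      (1 / \<bar>1 / a\<bar> ^ DIM(real)) *\<^sub>R K)
      ((\<lambda>u. (1 / (1 / a)) *\<^sub>R u + - ((1 / (1 / a)) *\<^sub>R (- b / a))) ` cbox p q)"
    using assms by (intro has_integral_affinity) auto
  moreover have "(\<lambda>u. (1 / (1 / a)) *\<^sub>R u + - ((1 / (1 / a)) *\<^sub>R (- b / a))) ` cbox p q =
      {a * p + b..a * q + b}"
    using \<open>0 < a\<close> True image_affinity_atLeastAtMost[of a b p q] by simp
  ultimately show ?thesis using \<open>0 < a\<close> by (simp add: diff_divide_distrib)
next
  \<comment> \<open>Both intervals are empty because \<open>a > 0\<close>, so
    \<open>K = 0\<close>.\<close>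
  case False
  then show ?thesis using assms by (simp add: has_integral_iff integrable_on_empty)
qed

section \<open>The integrals over the pieces and the constants \<open>d j\<close>\<close>

theorem theorem4:
  fixes N :: nat
    and t y a b c d \<delta> :: "nat \<Rightarrow> real"
    and l s :: "nat \<Rightarrow> real \<Rightarrow> real"
    and F :: "nat \<Rightarrow> real \<times> real \<Rightarrow> real"
    and w :: "nat \<Rightarrow> real \<times> real \<Rightarrow> real \<times> real"
    and \<psi> f :: "real \<Rightarrow> real"
  assumes "N > 1"
    and "\<forall>j\<in>{1..N}. t (j - 1) < t j"
    and "\<forall>j\<in>{1..N}. \<forall>u\<in>{t 0..t N}. l j u = a j * u + b j"
    and "\<forall>j\<in>{1..N}. l j (t 0) = t (j - 1) \<and> l j (t N) = t j"
    and "\<forall>j\<in>{1..N}. rakotch_contraction \<psi> (s j)"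
    and "\<forall>j\<in>{1..N}. \<forall>u\<in>{t 0..t N}. \<forall>x. F j (u, x) = c j * u + \<delta> j * s j x + d j"
    and "\<forall>j\<in>{1..N}. \<forall>u\<in>{t 0..t N}. \<forall>x. w j (u, x) = (l j u, F j (u, x))"
    and "Max ((\<lambda>j. \<bar>\<delta> j\<bar>) ` {1..N}) < 1"
    and "Max ((\<lambda>j. \<bar>a j\<bar>) ` {1..N}) < 1"
    and "f \<in> bounded_functions {t 0..t N}"
    and "\<forall>u\<in>{t 0..t N}. read_bajraktarevic t N l F f u = f u"
  shows "(\<forall>j\<in>{1..N}. (f has_integral y j * a j * (t N - t 0)) {t (j - 1)..t j}) \<longleftrightarrow>
         (\<forall>j\<in>{1..N}. d j =
            (2 * y j * (t N - t 0) - c j * ((t N)\<^sup>2 - (t 0)\<^sup>2)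
               - 2 * \<delta> j * integral {t 0..t N} (\<lambda>u. s j (f u)))
            / (2 * (t N - t 0)))"
proof -
  note partition = assms(2)
  have mono: "t i \<le> t k" if "i \<le> k" "k \<le> N" for i k
    using partition_le[OF partition that] .
  have len: "t 0 < t N"
    using partition_less[OF partition, of 0 N] assms(1) by simp
  have ends: "a j * t 0 + b j = t (j - 1)" "a j * t N + b j = t j" if "j \<in> {1..N}" for j
    using assms(3,4) that len by (metis atLeastAtMost_iff less_eq_real_def)+
  have a_pos: "0 < a j" if "j \<in> {1..N}" for j
  proof -
    have "a j * (t N - t 0) = t j - t (j - 1)"
      unfolding ends[OF that, symmetric] by (simp add: algebra_simps)
    moreover have "t (j - 1) < t j" using partition that by blast
    ultimately show ?thesis using len by (metis diff_gt_0_iff_gt zero_less_mult_pos2)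
  qed
  \<comment> \<open>The inverse of \<open>l j\<close> as an affine map on the whole line, hence
    Borel measurable; \<open>inv_into\<close> is shown to agree with it on the closed piece.\<close>
  define v where "v = (\<lambda>j u. (u - b j) / a j)"
  have v_mem: "v j u \<in> {t 0..t N}" if "j \<in> {1..N}" "u \<in> {t (j - 1)..t j}" for j u
    using that(2) a_pos[OF that(1)] unfolding ends[OF that(1), symmetric]
    by (simp add: v_def pos_le_divide_eq pos_divide_le_eq algebra_simps)
  have inv_l: "inv_into {t 0..t N} (l j) u = v j u"
    if "j \<in> {1..N}" "u \<in> {t (j - 1)..t j}" for j u
  proof (rule inv_into_f_eq)
    show "inj_on (l j) {t 0..t N}"
      using assms(3) that(1) a_pos[OF that(1)] by (intro inj_onI) force
    show "l j (v j u) = u"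
      using assms(3) that(1) a_pos[OF that(1)] v_mem[OF that] by (simp add: v_def)
  qed (rule v_mem[OF that])
  have f_eq: "f u = c j * v j u + \<delta> j * s j (f (v j u)) + d j"
    if j: "j \<in> {1..N}" and u: "u \<in> hist_interval t N j" for j u
  proof -
    have uj: "u \<in> {t (j - 1)..t j}" using u hist_interval_subset by blast
    moreover have "t 0 \<le> t (j - 1)" "t j \<le> t N" using j by (auto intro!: mono)
    ultimately have "f u = read_bajraktarevic t N l F f u" using assms(11) by auto
    moreover have "(THE j. j \<in> {1..N} \<and> u \<in> hist_interval t N j) = j"
      using j u hist_interval_unique[OF partition] by (intro the_equality) blast+
    ultimately have "f u = F j (v j u, f (v j u))"
      using inv_l[OF j uj] by (simp add: read_bajraktarevic_def Let_def)
    then show ?thesis using assms(6) j v_mem[OF j uj] by simp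
  qed
  \<comment> \<open>The contraction ratio of the operator: \<open>s j\<close> is nonexpansive and is
    scaled by \<open>\<delta> j\<close>.\<close>
  define q where "q = Max ((\<lambda>j. \<bar>\<delta> j\<bar>) ` {1..N})"
  have \<delta>_le: "\<bar>\<delta> j\<bar> \<le> q" if "j \<in> {1..N}" for j
    unfolding q_def using that by (intro Max_ge) auto
  have "0 \<le> q" using \<delta>_le[of 1] assms(1) by simp
  have bdd: "bounded (f ` {t 0..t N})" using assms(10) by (simp add: bounded_functions_def)
  have s_cont: "continuous_on UNIV (s j)" if "j \<in> {1..N}" for j
    using assms(5) that rakotch_contraction_continuous_on by blast
  have meas: "(\<lambda>u. indicator {t 0..t N} u * f u) \<in> borel_measurable borel"
  proof (rule piecewise_fixed_point_borel_measurable[where J = "{1..N}" and A = "hist_interval t N"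
        and v = v and \<Phi> = "\<lambda>j p x. c j * p + \<delta> j * s j x + d j" and q = q])
    show "hist_interval t N j \<in> sets borel" for j by (simp add: hist_interval_def)
    show "disjoint_family_on (hist_interval t N) {1..N}"
      unfolding disjoint_family_on_def using hist_interval_unique[OF partition] by blast
    show "{t 0..t N} \<subseteq> (\<Union>j\<in>{1..N}. hist_interval t N j)"
      using hist_interval_exists[of N _ t] assms(1) by auto
    show "v j \<in> borel_measurable borel" for j by (simp add: v_def)
    show "v j u \<in> {t 0..t N}" if "j \<in> {1..N}" "u \<in> hist_interval t N j" for j u
      using that v_mem hist_interval_subset by blast
    show "(\<lambda>(p, x). c j * p + \<delta> j * s j x + d j) \<in> borel_measurable (borel \<Otimes>\<^sub>M borel)"
      if "j \<in> {1..N}" for j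
    proof -
      have [measurable]: "s j \<in> borel_measurable borel"
        using s_cont[OF that] by (rule borel_measurable_continuous_onI)
      show ?thesis by measurable
    qed
    show "\<bar>(c j * p + \<delta> j * s j x + d j) - (c j * p + \<delta> j * s j z + d j)\<bar> \<le> q * \<bar>x - z\<bar>"
      if "j \<in> {1..N}" for j p x z
    proof -
      have "\<bar>s j x - s j z\<bar> \<le> \<bar>x - z\<bar>"
        using rakotch_contraction_dist_le[of \<psi> "s j" x z] assms(5) that by (simp add: dist_real_def)
      then have "\<bar>\<delta> j\<bar> * \<bar>s j x - s j z\<bar> \<le> q * \<bar>x - z\<bar>"
        using \<delta>_le[OF that] \<open>0 \<le> q\<close> by (intro mult_mono) auto
      then show ?thesis by (simp add: abs_mult[symmetric] right_diff_distrib)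
    qed
    show "q < 1" using assms(8) by (simp add: q_def)
  qed (use \<open>0 \<le> q\<close> bdd f_eq in auto)
  \<comment> \<open>The integral of \<open>c j * u + \<delta> j * s j (f u) + d j\<close> over the
    whole interval.\<close>
  define K where "K j = c j * (((t N)\<^sup>2 - (t 0)\<^sup>2) / 2)
    + \<delta> j * integral {t 0..t N} (\<lambda>u. s j (f u)) + d j * (t N - t 0)" for j
  have f_int: "(f has_integral a j * K j) {t (j - 1)..t j}" if j: "j \<in> {1..N}" for j
  proof -
    have "((\<lambda>u. s j (f u)) has_integral integral {t 0..t N} (\<lambda>u. s j (f u))) {t 0..t N}"
      using integrable_on_continuous_compose[OF s_cont[OF j] bdd meas] by (rule integrable_integral)
    moreover have "((\<lambda>u. u) has_integral ((t N)\<^sup>2 - (t 0)\<^sup>2) / 2) {t 0..t N}"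
      using len by (intro ident_has_integral) simp
    moreover have "((\<lambda>_. d j) has_integral d j * (t N - t 0)) {t 0..t N}"
      using has_integral_const_real[of "d j" "t 0" "t N"] len by (simp add: mult.commute)
    ultimately have "((\<lambda>u. c j * u + \<delta> j * s j (f u) + d j) has_integral K j) {t 0..t N}"
      unfolding K_def by (intro has_integral_add has_integral_mult_right)
    from has_integral_affine_image[OF this a_pos[OF j], of "b j"]
    have "((\<lambda>u. c j * v j u + \<delta> j * s j (f (v j u)) + d j) has_integral a j * K j)
        {t (j - 1)..t j}"
      unfolding ends[OF j] v_def .
    then show ?thesis
    \<comment> \<open>For \<open>j < N\<close> the right endpoint belongs to the next piece, where
      another branch defines \<open>f\<close>; a single point does not affect the integral.\<close>
    proof (rule has_integral_spike_finite[where S = "{t j}", rotated 2])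
      fix u assume "u \<in> {t (j - 1)..t j} - {t j}"
      then have "u \<in> hist_interval t N j" by (auto simp: hist_interval_def)
      then show "f u = c j * v j u + \<delta> j * s j (f (v j u)) + d j" by (rule f_eq[OF j])
    qed simp
  qed
  have "(f has_integral y j * a j * (t N - t 0)) {t (j - 1)..t j} \<longleftrightarrow>
      d j = (2 * y j * (t N - t 0) - c j * ((t N)\<^sup>2 - (t 0)\<^sup>2)
               - 2 * \<delta> j * integral {t 0..t N} (\<lambda>u. s j (f u))) / (2 * (t N - t 0))"
    if j: "j \<in> {1..N}" for j
  proof -
    \<comment> \<open>As \<open>f\<close> is already known to be integrable on the piece, uniqueness
      of the integral reduces the condition to an equation of numbers. It is linear in
      \<open>d j\<close>, and \<open>a j\<close> cancels.\<close>
    have "(f has_integral y j * a j * (t N - t 0)) {t (j - 1)..t j} \<longleftrightarrow>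
        a j * K j = y j * a j * (t N - t 0)"
      using f_int[OF j] has_integral_unique by metis
    also have "\<dots> \<longleftrightarrow> K j = y j * (t N - t 0)"
      using a_pos[OF j] by auto
    also have "\<dots> \<longleftrightarrow> d j * (2 * (t N - t 0)) = 2 * y j * (t N - t 0)
        - c j * ((t N)\<^sup>2 - (t 0)\<^sup>2) - 2 * \<delta> j * integral {t 0..t N} (\<lambda>u. s j (f u))"
      unfolding K_def by (auto simp: field_simps)
    finally show ?thesis using len by (simp add: eq_divide_eq)
  qed
  then show ?thesis by blast
qed

end
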